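(* (Design Composition Theorem II) For any two finite designs $D=\{m\}_n$ and $D'=\{m'\}_{n'}$, \[ U(DD')=U(D)\,U(D'), \] where $DD'=\{2^{n'}m+m'\}_{n+n'}$ is the concatenated word.
   Context: Stern's diatomic integers: for integers $n\ge0$, $0\le m\le 2^n$, define $[2^0:0]=0$, $[2^0:1]=1$, $[2^{n+1}:2m]=[2^n:m]$ ($0\le m\le 2^n$), $[2^{n+1}:2m+1]=[2^n:m]+[2^n:m+1]$ ($0\le m\le 2^n-1$). A finite design $\{m\}_n$ ($n\ge0$, $0\le m\le 2^n-1$) is the binary word of length $n$ (leading zeros allowed; $\{0\}_0$ is the empty word) representing $m$. For such a design, $U(\{m\}_n)=\begin{pmatrix}[2^n:m+1]&[2^n:m]\\ [2^n:2^n-(m+1)]&[2^n:2^n-m]\end{pmatrix}$. *)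

theory Defs
  imports "HOL-Analysis.Analysis"
begin

text \<open>
  \<open>stern n m\<close> is $[2^n : m]$. Only arguments with \<open>m \<le> 2 ^ n\<close> are meaningful.
\<close>

fun stern :: "nat \<Rightarrow> nat \<Rightarrow> int" where
  "stern 0 m = (if m = 1 then 1 else 0)"
| "stern (Suc n) m =
     (if even m then stern n (m div 2) else stern n (m div 2) + stern n (m div 2 + 1))"

lemma stern_rec:
  "stern 0 0 = 0"
  "stern 0 1 = 1"
  "stern (n + 1) (2 * m) = stern n m"
  "stern (n + 1) (2 * m + 1) = stern n m + stern n (m + 1)"
  by simp_all

text \<open>
  Finite designs are binary words, most significant digit first, with \<open>True\<close> as the digit 1.
  \<open>design n m\<close> is $\{m\}_n$, for \<open>m < 2 ^ n\<close>.
\<close>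

definition design :: "nat \<Rightarrow> nat \<Rightarrow> bool list" where
  "design n m = rev (map (bit m) [0..<n])"

definition word_value :: "bool list \<Rightarrow> nat" where
  "word_value w = horner_sum of_bool 2 (rev w)"

definition U :: "bool list \<Rightarrow> int ^ 2 ^ 2" where
  "U w = (let n = length w; m = word_value w in
     vector [vector [stern n (m + 1), stern n m],
             vector [stern n (2 ^ n - (m + 1)), stern n (2 ^ n - m)]])"

lemma length_design [simp]: "length (design n m) = n"
  by (simp add: design_def)

lemma word_value_design: "m < 2 ^ n \<Longrightarrow> word_value (design n m) = m"
  by (simp add: design_def word_value_def horner_sum_bit_eq_take_bit take_bit_nat_eq_self)

lemma U_design:
  assumes "m < 2 ^ n"
  shows "U (design n m) =
    vector [vector [stern n (m + 1), stern n m],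
            vector [stern n (2 ^ n - (m + 1)), stern n (2 ^ n - m)]]"
  using assms by (simp add: U_def word_value_design)

end

theory Submission
  imports Defs
begin

text \<open>
  Appending a single digit to a word multiplies \<open>U\<close> on the right by the elementary matrix of that
  digit: this is Stern's recursion read off in both rows. As \<open>U\<close> of the empty word is the identity,
  \<open>U\<close> is a monoid homomorphism from binary words to matrices.
\<close>

lemma word_value_Nil [simp]: "word_value [] = 0"
  by (simp add: word_value_def)

lemma word_value_snoc [simp]: "word_value (w @ [b]) = of_bool b + 2 * word_value w"
  by (simp add: word_value_def)

text \<open>Keeps the truncated subtractions in the bottom row of \<open>U\<close> exact.\<close>

lemma word_value_less: "word_value w < 2 ^ length w"
  by (induction w rule: rev_induct) auto

lemma U_Nil: "U [] = mat 1"
  by (simp add: U_def mat_def vec_eq_iff forall_2)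

lemma U_snoc: "U (w @ [b]) = U w ** U [b]"
proof -
  define n m where "n = length w" and "m = word_value w"
  \<comment> \<open>\<open>k\<close> is the value of the bitwise complement of \<open>w\<close>. The
    bottom row of \<open>U w\<close> is thus the top row with \<open>m\<close> replaced by
    \<open>k\<close> and its entries swapped.\<close>
  define k where "k = 2 ^ n - (m + 1)"
  have "m < 2 ^ n"
    unfolding n_def m_def by (rule word_value_less)
  then have k: "2 ^ n - (m + 1) = k" "2 ^ n - m = k + 1"
    "2 ^ Suc n - 2 * m = 2 * (k + 1)" "2 ^ Suc n - (2 * m + 1) = 2 * k + 1"
    "2 ^ Suc n - (2 * m + 2) = 2 * k"
    by (auto simp: k_def)
  have w: "U w = vector [vector [stern n (m + 1), stern n m], vector [stern n k, stern n (k + 1)]]"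
    by (simp only: U_def Let_def n_def[symmetric] m_def[symmetric] k)
  have value_singleton: "word_value [b] = of_bool b"
    using word_value_snoc[of "[]" b] by simp
  show ?thesis
  proof (cases b)
    case True
    \<comment> \<open>Digit 1 turns \<open>m\<close> into \<open>2 * m + 1\<close> and its
      complement \<open>k\<close> into \<open>2 * k\<close>. By the recursion the first column stays
      and the second becomes the sum of both.\<close>
    have "U (w @ [b]) = vector [vector [stern (Suc n) (2 * m + 2), stern (Suc n) (2 * m + 1)],
        vector [stern (Suc n) (2 * k), stern (Suc n) (2 * k + 1)]]"
      using True by (simp add: U_def Let_def n_def[symmetric] m_def[symmetric] k[simplified]
          del: stern.simps)
    moreover have "U [b] = vector [vector [1, 1], vector [0, 1]]"
      using True value_singleton by (simp add: U_def)
    ultimately show ?thesis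
      by (simp add: w matrix_matrix_mult_def vec_eq_iff forall_2 sum_2)
  next
    case False
    \<comment> \<open>For digit 0 the roles are exchanged: the second column stays and the first
      becomes the sum.\<close>
    have "U (w @ [b]) = vector [vector [stern (Suc n) (2 * m + 1), stern (Suc n) (2 * m)],
        vector [stern (Suc n) (2 * k + 1), stern (Suc n) (2 * (k + 1))]]"
      using False by (simp add: U_def Let_def n_def[symmetric] m_def[symmetric] k[simplified]
          del: stern.simps)
    moreover have "U [b] = vector [vector [1, 0], vector [1, 1]]"
      using False value_singleton by (simp add: U_def)
    ultimately show ?thesis
      by (simp add: w matrix_matrix_mult_def vec_eq_iff forall_2 sum_2)
  qed
qed

theorem U_append: "U (v @ w) = U v ** U w"
proof (induction w rule: rev_induct)
  case Nil
  show ?case by (simp add: U_Nil)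
next
  case (snoc b w)
  have "U (v @ w @ [b]) = U (v @ w) ** U [b]"
    using U_snoc[of "v @ w" b] by simp
  also have "\<dots> = U v ** U (w @ [b])"
    by (simp add: snoc U_snoc[of w b] matrix_mul_assoc)
  finally show ?case .
qed

text \<open>As \<open>m' < 2 ^ n'\<close>, the sum has no carries: its low \<open>n'\<close> bits
  are those of \<open>m'\<close>, and the higher ones are those of \<open>m\<close> shifted by
  \<open>n'\<close>.\<close>

lemma design_append:
  assumes "m' < 2 ^ n'"
  shows "design n m @ design n' m' = design (n + n') (2 ^ n' * m + m')"
proof -
  let ?x = "2 ^ n' * m + m'"
  have low: "bit ?x i = bit m' i" if "i < n'" for i
  proof -
    have "take_bit n' ?x = m'"
      using assms by (simp add: take_bit_eq_mod)
    then show ?thesis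
      using that bit_take_bit_iff[of n' ?x i] by simp
  qed
  have high: "bit ?x i = bit m (i - n')" if "\<not> i < n'" for i
  proof -
    have "drop_bit n' ?x = m"
      using assms by (simp add: drop_bit_eq_div)
    then show ?thesis
      using that bit_drop_bit_eq[of n' ?x] by (metis comp_apply le_add_diff_inverse not_less)
  qed
  \<comment> \<open>Here the least significant bit comes first, so \<open>m'\<close> precedes
    \<open>m\<close>; the \<open>rev\<close> in \<open>design\<close> restores the order.\<close>
  have "map (bit ?x) [0..<n + n'] = map (bit m') [0..<n'] @ map (bit m) [0..<n]"
    by (rule nth_equalityI) (auto simp: nth_append low high)
  then show ?thesis
    by (simp add: design_def)
qed

theorem theorem6p12:
  fixes n n' m m' :: nat
  assumes "m < 2 ^ n" and "m' < 2 ^ n'"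
  shows "design n m @ design n' m' = design (n + n') (2 ^ n' * m + m')
       \<and> U (design n m @ design n' m') = U (design n m) ** U (design n' m')"
  using design_append[OF assms(2)] U_append by blast

end
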